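(* For every integer $k>1$, the subgroup $H_k=\langle a_1t,\dots,a_kt\rangle$ is not separable in $$G_k=\langle a_1,\dots,a_k,t\mid a_1^t=a_1,\ a_i^t=a_ia_{i-1}\ (1<i\le k)\rangle.$$
   Context: Convention: $a^b:=b^{-1}ab$. A subgroup $H\le G$ is separable in $G$ if for every $g\in G\setminus H$ there is a homomorphism $\phi$ from $G$ onto a finite group with $\phi(g)\notin\phi(H)$; equivalently, $H$ is the intersection of all finite-index subgroups of $G$ containing $H$. *)

theory Defs
  imports "HOL-Algebra.Generated_Groups"
begin

section \<open>Groups given by generators and relations\<close>

text \<open>
  A letter \<open>(x, True)\<close> stands for the generator \<open>x\<close>, and \<open>(x, False)\<close> for its formal inverse.
\<close>

type_synonym 'g word = "('g \<times> bool) list"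

definition words :: "'g set \<Rightarrow> 'g word set" where
  "words S = lists (S \<times> UNIV)"

definition word_inv :: "'g word \<Rightarrow> 'g word" where
  "word_inv w = rev (map (\<lambda>(x, b). (x, \<not> b)) w)"

text \<open>The convention for conjugation is \<open>u\<^sup>v = v\<^sup>-\<^sup>1 u v\<close>.\<close>

definition word_conj :: "'g word \<Rightarrow> 'g word \<Rightarrow> 'g word" where
  "word_conj u v = word_inv v @ u @ v"

text \<open>
  The least congruence on the monoid of words over \<open>S\<close> that contains the trivial cancellations
  and the relations \<open>u = v\<close> for \<open>(u, v) \<in> R\<close>.
\<close>

inductive_set pres_rel :: "'g set \<Rightarrow> ('g word \<times> 'g word) set \<Rightarrow> ('g word \<times> 'g word) set"
  for S :: "'g set" and R :: "('g word \<times> 'g word) set" where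
  pres_refl: "w \<in> words S \<Longrightarrow> (w, w) \<in> pres_rel S R"
| pres_sym: "(u, v) \<in> pres_rel S R \<Longrightarrow> (v, u) \<in> pres_rel S R"
| pres_trans: "(u, v) \<in> pres_rel S R \<Longrightarrow> (v, w) \<in> pres_rel S R \<Longrightarrow> (u, w) \<in> pres_rel S R"
| pres_append: "(u, u') \<in> pres_rel S R \<Longrightarrow> (v, v') \<in> pres_rel S R
    \<Longrightarrow> (u @ v, u' @ v') \<in> pres_rel S R"
| pres_cancel: "x \<in> S \<Longrightarrow> ([(x, b), (x, \<not> b)], []) \<in> pres_rel S R"
| pres_relation: "(u, v) \<in> R \<Longrightarrow> u \<in> words S \<Longrightarrow> v \<in> words S \<Longrightarrow> (u, v) \<in> pres_rel S R"

definition word_class :: "'g set \<Rightarrow> ('g word \<times> 'g word) set \<Rightarrow> 'g word \<Rightarrow> 'g word set" where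
  "word_class S R w = pres_rel S R `` {w}"

definition presented_group :: "'g set \<Rightarrow> ('g word \<times> 'g word) set \<Rightarrow> 'g word set monoid" where
  "presented_group S R =
     \<lparr>carrier = words S // pres_rel S R,
      mult = (\<lambda>U V. \<Union>u\<in>U. \<Union>v\<in>V. word_class S R (u @ v)),
      one = word_class S R []\<rparr>"

lemma words_Nil [simp]: "[] \<in> words S"
  by (simp add: words_def)

lemma words_Cons [simp]: "p # w \<in> words S \<longleftrightarrow> fst p \<in> S \<and> w \<in> words S"
  by (cases p) (auto simp: words_def)

lemma words_append [simp]: "u @ v \<in> words S \<longleftrightarrow> u \<in> words S \<and> v \<in> words S"
  by (auto simp: words_def)

lemma word_inv_Nil [simp]: "word_inv [] = []"
  by (simp add: word_inv_def)

lemma word_inv_Cons [simp]: "word_inv ((x, b) # w) = word_inv w @ [(x, \<not> b)]"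
  by (simp add: word_inv_def)

lemma word_inv_in_words [simp]: "w \<in> words S \<Longrightarrow> word_inv w \<in> words S"
  by (induction w) auto

lemma pres_rel_in_words:
  "(u, v) \<in> pres_rel S R \<Longrightarrow> u \<in> words S \<and> v \<in> words S"
  by (induction rule: pres_rel.induct) auto

lemma equiv_pres_rel: "equiv (words S) (pres_rel S R)"
  by (rule equivI)
     (use pres_rel_in_words in \<open>auto simp: refl_on_def sym_def
        intro: transI pres_refl pres_sym pres_trans\<close>)

lemma word_class_eq_iff:
  assumes "u \<in> words S" "v \<in> words S"
  shows "word_class S R u = word_class S R v \<longleftrightarrow> (u, v) \<in> pres_rel S R"
  unfolding word_class_def using eq_equiv_class_iff[OF equiv_pres_rel] assms by blast

lemma word_class_carrier [simp]:
  "w \<in> words S \<Longrightarrow> word_class S R w \<in> carrier (presented_group S R)"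
  by (simp add: presented_group_def word_class_def quotientI)

lemma presented_group_carrierE:
  assumes "U \<in> carrier (presented_group S R)"
  obtains w where "w \<in> words S" "U = word_class S R w"
  using assms by (auto simp: presented_group_def word_class_def elim: quotientE)

lemma word_class_mult [simp]:
  assumes "u \<in> words S" "v \<in> words S"
  shows "word_class S R u \<otimes>\<^bsub>presented_group S R\<^esub> word_class S R v = word_class S R (u @ v)"
proof -
  have *: "word_class S R (u' @ v') = word_class S R (u @ v)"
    if "u' \<in> word_class S R u" "v' \<in> word_class S R v" for u' v'
  proof -
    have "(u, u') \<in> pres_rel S R" "(v, v') \<in> pres_rel S R"
      using that by (auto simp: word_class_def)
    then show ?thesis
      using word_class_eq_iff[of "u @ v" S "u' @ v'" R] pres_append pres_rel_in_words
      by (metis words_append)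
  qed
  moreover have "u \<in> word_class S R u" "v \<in> word_class S R v"
    using assms by (auto simp: word_class_def intro: pres_refl)
  ultimately have "(\<Union>u'\<in>word_class S R u. \<Union>v'\<in>word_class S R v. word_class S R (u' @ v'))
      = word_class S R (u @ v)"
    by blast
  then show ?thesis by (simp add: presented_group_def)
qed

lemma one_presented_group: "\<one>\<^bsub>presented_group S R\<^esub> = word_class S R []"
  by (simp add: presented_group_def)

lemma pres_rel_word_inv:
  "w \<in> words S \<Longrightarrow> (word_inv w @ w, []) \<in> pres_rel S R"
proof (induction w)
  case Nil
  then show ?case by (simp add: pres_refl)
next
  case (Cons p w)
  obtain x b where p: "p = (x, b)" by (cases p)
  have x: "x \<in> S" and w: "w \<in> words S" using Cons.prems p by auto
  have "([(x, \<not> b), (x, b)], []) \<in> pres_rel S R"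
    using pres_cancel[OF x, of "\<not> b"] by simp
  then have "([(x, \<not> b), (x, b)] @ w, [] @ w) \<in> pres_rel S R"
    using w by (intro pres_append pres_refl)
  then have "(word_inv w @ ([(x, \<not> b), (x, b)] @ w), word_inv w @ ([] @ w)) \<in> pres_rel S R"
    using w by (intro pres_append[of "word_inv w"] pres_refl) simp_all
  then show ?case using Cons.IH[OF w] p by (auto intro: pres_trans)
qed

lemma group_presented_group: "group (presented_group S R)"
proof (rule groupI)
  fix U V assume "U \<in> carrier (presented_group S R)" "V \<in> carrier (presented_group S R)"
  then show "U \<otimes>\<^bsub>presented_group S R\<^esub> V \<in> carrier (presented_group S R)"
    by (auto elim!: presented_group_carrierE)
next
  fix U V W
  assume "U \<in> carrier (presented_group S R)" "V \<in> carrier (presented_group S R)"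
    "W \<in> carrier (presented_group S R)"
  then show "U \<otimes>\<^bsub>presented_group S R\<^esub> V \<otimes>\<^bsub>presented_group S R\<^esub> W
      = U \<otimes>\<^bsub>presented_group S R\<^esub> (V \<otimes>\<^bsub>presented_group S R\<^esub> W)"
    by (auto elim!: presented_group_carrierE)
next
  fix U assume "U \<in> carrier (presented_group S R)"
  then show "\<one>\<^bsub>presented_group S R\<^esub> \<otimes>\<^bsub>presented_group S R\<^esub> U = U"
    by (auto simp: one_presented_group elim!: presented_group_carrierE)
next
  fix U assume "U \<in> carrier (presented_group S R)"
  then obtain w where w: "w \<in> words S" "U = word_class S R w"
    by (rule presented_group_carrierE)
  show "\<exists>V\<in>carrier (presented_group S R).
      V \<otimes>\<^bsub>presented_group S R\<^esub> U = \<one>\<^bsub>presented_group S R\<^esub>"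
    using w pres_rel_word_inv[of w S R]
    by (intro bexI[of _ "word_class S R (word_inv w)"])
       (auto simp: one_presented_group word_class_eq_iff)
qed (simp add: one_presented_group)

text \<open>
  Evaluation of a word in a group. The next results show that \<open>presented_group S R\<close> has the
  universal property of a presentation: an assignment of the generators extends to a (unique, as
  the generators generate) homomorphism as soon as it satisfies the relations.
\<close>

definition eval_word :: "('a, 'b) monoid_scheme \<Rightarrow> ('g \<Rightarrow> 'a) \<Rightarrow> 'g word \<Rightarrow> 'a" where
  "eval_word K f w =
     foldr (\<lambda>(x, b) y. (if b then f x else inv\<^bsub>K\<^esub> (f x)) \<otimes>\<^bsub>K\<^esub> y) w \<one>\<^bsub>K\<^esub>"

lemma (in group) eval_word_closed [simp]:
  "f \<in> S \<rightarrow> carrier G \<Longrightarrow> w \<in> words S \<Longrightarrow> eval_word G f w \<in> carrier G"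
  by (induction w) (auto simp: eval_word_def Pi_iff)

lemma (in group) eval_word_append:
  fixes f :: "'g \<Rightarrow> 'a"
  shows "f \<in> S \<rightarrow> carrier G \<Longrightarrow> u \<in> words S \<Longrightarrow> v \<in> words S
     \<Longrightarrow> eval_word G f (u @ v) = eval_word G f u \<otimes> eval_word G f v"
proof (induction u)
  case Nil
  have "eval_word G f ([] :: 'g word) = \<one>" by (simp add: eval_word_def)
  with Nil show ?case using eval_word_closed[of f S v] by simp
next
  case (Cons p u)
  obtain x b where p: "p = (x, b)" by (cases p)
  have x: "f x \<in> carrier G" using Cons.prems p by auto
  have E: "eval_word G f (p # w) = (if b then f x else inv (f x)) \<otimes> eval_word G f w" for w
    by (simp add: eval_word_def p)
  have u: "eval_word G f u \<in> carrier G" and v: "eval_word G f v \<in> carrier G"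
    using Cons.prems eval_word_closed[of f S] by auto
  have "eval_word G f (u @ v) = eval_word G f u \<otimes> eval_word G f v"
    using Cons by auto
  then show ?case using x u v by (simp add: E m_assoc)
qed

lemma (in group) eval_word_respects:
  assumes f: "f \<in> S \<rightarrow> carrier G"
    and R: "\<And>u v. (u, v) \<in> R \<Longrightarrow> u \<in> words S \<Longrightarrow> v \<in> words S
              \<Longrightarrow> eval_word G f u = eval_word G f v"
  shows "(u, v) \<in> pres_rel S R \<Longrightarrow> eval_word G f u = eval_word G f v"
proof (induction rule: pres_rel.induct)
  case (pres_append u u' v v')
  then show ?case using pres_rel_in_words eval_word_append[OF f] by metis
next
  case (pres_cancel x b)
  then show ?case using f by (auto simp: eval_word_def Pi_iff)
qed (use R in auto)

lemma (in group) presented_group_universal: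
  assumes f: "f \<in> S \<rightarrow> carrier G"
    and R: "\<And>u v. (u, v) \<in> R \<Longrightarrow> u \<in> words S \<Longrightarrow> v \<in> words S
              \<Longrightarrow> eval_word G f u = eval_word G f v"
  shows "\<exists>\<phi> \<in> hom (presented_group S R) G.
           \<forall>w\<in>words S. \<phi> (word_class S R w) = eval_word G f w"
proof -
  define \<phi> where "\<phi> U = eval_word G f (SOME w. w \<in> U)" for U
  have \<phi>: "\<phi> (word_class S R w) = eval_word G f w" if w: "w \<in> words S" for w
  proof -
    have "w \<in> word_class S R w" using w by (auto simp: word_class_def intro: pres_refl)
    then have "(SOME w'. w' \<in> word_class S R w) \<in> word_class S R w" by (rule someI)
    then show ?thesis
      using eval_word_respects[OF f R] by (auto simp: \<phi>_def word_class_def)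
  qed
  have "\<phi> \<in> hom (presented_group S R) G"
    by (rule homI) (auto elim!: presented_group_carrierE
        simp: \<phi> eval_word_append[OF f] eval_word_closed[OF f])
  with \<phi> show ?thesis by blast
qed

section \<open>Separable subgroups\<close>

text \<open>
  HOL cannot quantify existentially over types, so the finite quotients range over groups whose
  elements are natural numbers. Every finite group is isomorphic to such a group, so nothing is
  lost: see \<open>separableI\<close>, which accepts finite quotients over an arbitrary type.
\<close>

definition separable :: "('a, 'b) monoid_scheme \<Rightarrow> 'a set \<Rightarrow> bool" where
  "separable G H \<longleftrightarrow>
     (\<forall>g \<in> carrier G - H. \<exists>(Q :: nat monoid) \<phi>.
        group Q \<and> finite (carrier Q) \<and> \<phi> \<in> epi G Q \<and> \<phi> g \<notin> \<phi> ` H)"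

lemma finite_group_nat_copy:
  fixes Q :: "('c, 'd) monoid_scheme"
  assumes "group Q" "finite (carrier Q)"
  shows "\<exists>(Q' :: nat monoid) h. group Q' \<and> finite (carrier Q') \<and> h \<in> iso Q Q'"
proof -
  obtain e :: "'c \<Rightarrow> nat" where e: "inj_on e (carrier Q)"
    using finite_imp_inj_to_nat_seg[OF assms(2)] by blast
  define d where "d = the_inv_into (carrier Q) e"
  define Q' :: "nat monoid" where
    "Q' = \<lparr>carrier = e ` carrier Q, mult = (\<lambda>x y. e (d x \<otimes>\<^bsub>Q\<^esub> d y)), one = e \<one>\<^bsub>Q\<^esub>\<rparr>"
  have d: "d (e x) = x" if "x \<in> carrier Q" for x
    using that e by (simp add: d_def the_inv_into_f_f)
  interpret Q: group Q by fact
  have iso: "e \<in> iso Q Q'"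
    by (rule isoI) (auto simp: hom_def Q'_def d bij_betw_def e)
  have "group (Q' \<lparr>one := e \<one>\<^bsub>Q\<^esub>\<rparr>)"
    by (rule Q.iso_imp_img_group[OF iso])
  then have "group Q'" by (simp add: Q'_def)
  moreover have "finite (carrier Q')" using assms(2) by (simp add: Q'_def)
  ultimately show ?thesis using iso by blast
qed

lemma separableI:
  fixes G :: "('a, 'b) monoid_scheme" and H :: "'a set"
  assumes H: "H \<subseteq> carrier G"
    and Q: "\<And>g. g \<in> carrier G - H \<Longrightarrow> \<exists>(Q :: ('c, 'd) monoid_scheme) \<phi>.
              group Q \<and> finite (carrier Q) \<and> \<phi> \<in> epi G Q \<and> \<phi> g \<notin> \<phi> ` H"
  shows "separable G H"
  unfolding separable_def
proof
  fix g assume g: "g \<in> carrier G - H"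
  from Q[OF g] obtain Q :: "('c, 'd) monoid_scheme" and \<phi>
    where Q: "group Q" "finite (carrier Q)" "\<phi> \<in> epi G Q" "\<phi> g \<notin> \<phi> ` H"
    by blast
  obtain Q' :: "nat monoid" and h where Q': "group Q'" "finite (carrier Q')" "h \<in> iso Q Q'"
    using finite_group_nat_copy[OF Q(1,2)] by blast
  have h: "h \<in> epi Q Q'" and inj: "inj_on h (carrier Q)"
    using Q'(3) by (auto simp: iso_iff_mon_epi mon_def)
  have "\<phi> x \<in> carrier Q" if "x \<in> carrier G" for x
    using Q(3) that by (auto simp: epi_def hom_def)
  then have "(h \<circ> \<phi>) g \<notin> (h \<circ> \<phi>) ` H"
    using Q(4) g H inj by (auto simp: inj_on_def image_iff) (metis subsetD)
  moreover have "h \<circ> \<phi> \<in> epi G Q'" using epi_compose[OF Q(3) h] .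
  ultimately show "\<exists>(Q :: nat monoid) \<phi>.
      group Q \<and> finite (carrier Q) \<and> \<phi> \<in> epi G Q \<and> \<phi> g \<notin> \<phi> ` H"
    using Q'(1,2) by blast
qed

section \<open>The groups \<open>G\<^sub>k\<close> and their subgroups \<open>H\<^sub>k\<close>\<close>

datatype gen = A nat | T

definition aw :: "nat \<Rightarrow> gen word" where
  "aw i = [(A i, True)]"

definition tw :: "gen word" where
  "tw = [(T, True)]"

definition gens_G :: "nat \<Rightarrow> gen set" where
  "gens_G k = A ` {1..k} \<union> {T}"

definition rels_G :: "nat \<Rightarrow> (gen word \<times> gen word) set" where
  "rels_G k = {(word_conj (aw 1) tw, aw 1)}
     \<union> {(word_conj (aw i) tw, aw i @ aw (i - 1)) | i. 1 < i \<and> i \<le> k}"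

definition G_grp :: "nat \<Rightarrow> gen word set monoid" where
  "G_grp k = presented_group (gens_G k) (rels_G k)"

definition a_elt :: "nat \<Rightarrow> nat \<Rightarrow> gen word set" where
  "a_elt k i = word_class (gens_G k) (rels_G k) (aw i)"

definition t_elt :: "nat \<Rightarrow> gen word set" where
  "t_elt k = word_class (gens_G k) (rels_G k) tw"

definition H_sub :: "nat \<Rightarrow> gen word set set" where
  "H_sub k = generate (G_grp k) ((\<lambda>i. a_elt k i \<otimes>\<^bsub>G_grp k\<^esub> t_elt k) ` {1..k})"

lemma group_G_grp: "group (G_grp k)"
  unfolding G_grp_def by (rule group_presented_group)

lemma a_elt_carrier: "1 \<le> i \<Longrightarrow> i \<le> k \<Longrightarrow> a_elt k i \<in> carrier (G_grp k)"
  by (simp add: a_elt_def G_grp_def aw_def gens_G_def)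

lemma t_elt_carrier: "t_elt k \<in> carrier (G_grp k)"
  by (simp add: t_elt_def G_grp_def tw_def gens_G_def)

lemma subgroup_H_sub: "subgroup (H_sub k) (G_grp k)"
  unfolding H_sub_def
  by (intro group.generate_is_subgroup group_G_grp)
     (auto intro!: monoid.m_closed group.is_monoid group_G_grp a_elt_carrier t_elt_carrier)

end

theory Submission
  imports Defs "HOL-Algebra.Bij" "HOL-Algebra.Multiplicative_Group" "HOL-Library.Countable_Set"
begin

text \<open>
  Put \<open>s\<^sub>i = a\<^sub>i t\<close>. The relations say that \<open>s\<^sub>1\<close> commutes with \<open>t\<close> and that
  \<open>s\<^sub>i\<^sup>-\<^sup>1 t s\<^sub>i = t s\<^sub>i\<^sub>-\<^sub>1\<^sup>-\<^sup>1 t\<close>. With \<open>y = s\<^sub>2\<close> this gives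
  \<open>y\<^sup>-\<^sup>m t y\<^sup>m \<in> t\<^sup>j H\<^sub>k\<close> for \<open>j = 2\<^sup>m\<close>. In a finite quotient \<open>y\<^sup>-\<^sup>1\<close> is such a power
  \<open>y\<^sup>m\<close>, so the image of \<open>z = y t y\<^sup>-\<^sup>1\<close> has the form \<open>t\<^sup>j h\<close> with \<open>h\<close> in the image of \<open>H\<^sub>k\<close>, and
  \<open>z\<^sup>-\<^sup>1 s\<^sub>1 z\<close> is mapped to \<open>h\<^sup>-\<^sup>1 s\<^sub>1 h\<close>. On the other hand, \<open>z\<^sup>-\<^sup>1 s\<^sub>1 z \<notin> H\<^sub>k\<close>, because there is
  an action of \<open>G\<^sub>k\<close> in which all \<open>s\<^sub>i\<close> fix a point that \<open>z\<^sup>-\<^sup>1 s\<^sub>1 z\<close> moves. It is built by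
  recursion on \<open>k\<close>: once \<open>t\<close> and \<open>t s\<^sub>k\<^sup>-\<^sup>1 t\<close> both have infinite orbits at the fixed point, the
  set can be enlarged so that the two permutations become conjugate.
\<close>

section \<open>Finite quotients\<close>

text \<open>Here the group is the finite quotient, \<open>K\<close> the image of
  \<open>H_sub k\<close>, and \<open>s\<close>, \<open>y\<close> the images of \<open>a_1 t\<close>,
  \<open>a_2 t\<close>. As \<open>s\<close> commutes with \<open>t\<close>, conjugation by
  \<open>y\<close> takes \<open>t^j\<close> to \<open>t^(2j) s^(-j)\<close>, which lies in
  \<open>t^(2j) K\<close>.\<close>

lemma (in group) twisted_conjugate_in_subgroup:
  assumes fin: "finite (carrier G)" and K: "subgroup K G"
    and t: "t \<in> carrier G" and s: "s \<in> K" and y: "y \<in> K"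
    and ST: "s \<otimes> t = t \<otimes> s"
    and TY: "t \<otimes> y = y \<otimes> (t \<otimes> t \<otimes> inv s)"
  shows "inv (y \<otimes> t \<otimes> inv y) \<otimes> s \<otimes> (y \<otimes> t \<otimes> inv y) \<in> K"
proof -
  interpret K: subgroup K G by (rule K)
  have Sc [simp]: "s \<in> carrier G" and Yc [simp]: "y \<in> carrier G" using s y by auto
  note t [simp]
  have ST_pow: "s \<otimes> t [^] j = t [^] j \<otimes> s" for j :: nat
    by (rule group_commutes_pow[symmetric]) (use ST in auto)
  have iST: "inv s \<otimes> t = t \<otimes> inv s"
    by (metis ST Sc t inv_closed inv_solve_left inv_solve_right m_assoc m_closed)
  have pow_s: "inv s [^] j \<in> K" for j :: nat
    using s by (induction j) (simp_all add: K.m_closed K.m_inv_closed K.one_closed)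
  have pow_Y: "\<exists>h\<in>K. t [^] j \<otimes> y = y \<otimes> t [^] (2 * j) \<otimes> h" for j :: nat
  proof -
    have "t [^] j \<otimes> y = y \<otimes> (t \<otimes> t \<otimes> inv s) [^] j"
    proof (induction j)
      case (Suc j)
      have "t [^] Suc j \<otimes> y = t [^] j \<otimes> (y \<otimes> (t \<otimes> t \<otimes> inv s))"
        by (simp add: m_assoc TY)
      also have "\<dots> = (t [^] j \<otimes> y) \<otimes> (t \<otimes> t \<otimes> inv s)"
        by (simp add: m_assoc)
      finally show ?case by (simp add: Suc m_assoc)
    qed simp
    also have "(t \<otimes> t \<otimes> inv s) [^] j = (t \<otimes> t) [^] j \<otimes> inv s [^] j"
      by (rule pow_mult_distrib) (metis iST m_assoc t inv_closed Sc m_closed, simp_all)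
    also have "(t \<otimes> t) [^] j = t [^] (2 * j)"
      by (metis t nat_pow_pow numeral_2_eq_2 nat_pow_Suc nat_pow_0 l_one)
    finally show ?thesis
      using pow_s by (intro bexI[of _ "inv s [^] j"]) (simp_all add: m_assoc)
  qed
  have conj_pow: "\<exists>j::nat. \<exists>h\<in>K. t \<otimes> y [^] m = y [^] m \<otimes> t [^] j \<otimes> h" for m :: nat
  proof (induction m)
    case 0
    show ?case by (rule exI[of _ 1], rule bexI[of _ \<one>]) (simp_all add: K.one_closed)
  next
    case (Suc m)
    then obtain j :: nat and h where h: "h \<in> K" "t \<otimes> y [^] m = y [^] m \<otimes> t [^] j \<otimes> h" by blast
    obtain h' where h': "h' \<in> K" "t [^] j \<otimes> y = y \<otimes> t [^] (2 * j) \<otimes> h'" using pow_Y by blast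
    have c [simp]: "h \<in> carrier G" "h' \<in> carrier G" using h h' by auto
    have "t \<otimes> y [^] Suc m = y [^] m \<otimes> t [^] j \<otimes> h \<otimes> y"
      using h(2) by (simp flip: m_assoc)
    \<comment> \<open>Moving \<open>h\<close> past \<open>y\<close> replaces it by its conjugate,
      which stays in \<open>K\<close> because \<open>y\<close> does.\<close>
    also have "\<dots> = y [^] m \<otimes> (t [^] j \<otimes> y) \<otimes> (inv y \<otimes> h \<otimes> y)"
      by (simp add: m_assoc inv_solve_left')
        (metis Yc c(1) inv_closed l_one m_assoc m_closed r_inv)
    also have "\<dots> = y [^] Suc m \<otimes> t [^] (2 * j) \<otimes> (h' \<otimes> (inv y \<otimes> h \<otimes> y))"
      by (simp add: h'(2) m_assoc)
    finally show ?case using h(1) h'(1) y by (blast intro: K.m_closed K.m_inv_closed)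
  qed
  \<comment> \<open>Finiteness enters here: the inverse is a power with natural exponent, so
    \<open>conj_pow\<close> applies to it.\<close>
  have "y [^] (order G - 1) = inv y"
  proof -
    have "y [^] (order G - 1) \<otimes> y = y [^] (order G)"
      using order_gt_0_iff_finite fin by (metis Suc_pred' nat_pow_Suc)
    then show ?thesis using pow_order_eq_1[of y] by (simp add: inv_equality)
  qed
  with conj_pow[of "order G - 1"] obtain j :: nat and h
    where h: "h \<in> K" "t \<otimes> inv y = inv y \<otimes> t [^] j \<otimes> h" by auto
  have hc [simp]: "h \<in> carrier G" using h by auto
  have "y \<otimes> t \<otimes> inv y = y \<otimes> (inv y \<otimes> t [^] j \<otimes> h)"
    using h(2) by (simp add: m_assoc)
  also have "\<dots> = t [^] j \<otimes> h" by (simp flip: m_assoc)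
  finally have YTY: "y \<otimes> t \<otimes> inv y = t [^] j \<otimes> h" .
  have "inv (t [^] j \<otimes> h) \<otimes> s \<otimes> (t [^] j \<otimes> h) = inv h \<otimes> (inv (t [^] j) \<otimes> (s \<otimes> t [^] j)) \<otimes> h"
    by (simp add: inv_mult_group m_assoc)
  also have "inv (t [^] j) \<otimes> (s \<otimes> t [^] j) = s"
    by (simp add: ST_pow flip: m_assoc)
  finally show ?thesis using s h by (simp add: YTY K.m_closed K.m_inv_closed)
qed

section \<open>Permutation actions\<close>

abbreviation (input) fun_inv :: "('x \<Rightarrow> 'y) \<Rightarrow> 'y \<Rightarrow> 'x" where
  "fun_inv \<equiv> inv_into UNIV"

text \<open>
  Here \<open>v i\<close> is the action of \<open>(a\<^sub>i t)\<^sup>-\<^sup>1\<close>; in terms of these elements the relations of \<open>G\<^sub>k\<close> contain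
  no inverses. The last conjunct says that \<open>z\<^sup>-\<^sup>1 s\<^sub>1 z\<close> moves \<open>p\<close>, where \<open>q = z p\<close>.
\<close>

definition hydra_action :: "nat \<Rightarrow> ('x \<Rightarrow> 'x) \<Rightarrow> (nat \<Rightarrow> 'x \<Rightarrow> 'x) \<Rightarrow> 'x \<Rightarrow> bool" where
  "hydra_action k t v p \<longleftrightarrow>
     bij t \<and> (\<forall>i\<in>{1..k}. bij (v i) \<and> v i p = p) \<and>
     (\<forall>x. v 1 (t x) = t (v 1 x)) \<and>
     (\<forall>i x. 1 \<le> i \<and> i < k \<longrightarrow> v (Suc i) (t x) = t (v i (t (v (Suc i) x)))) \<and>
     (\<forall>n>0. (t ^^ n) p \<noteq> p) \<and>
     (\<exists>q. v 2 q = t p \<and> v 1 q \<noteq> q)"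

section \<open>The base action, for \<open>k = 2\<close>\<close>

definition half_ind :: "rat \<Rightarrow> int" where
  "half_ind x = (if frac x = 1 / 2 then 1 else 0)"

lemma half_ind_add_1: "half_ind (x + 1) = half_ind x"
  by (simp add: half_ind_def frac_1_eq)

lemma half_ind_add_2: "half_ind (x + 2) = half_ind x"
  using half_ind_add_1[of "x + 1"] half_ind_add_1[of x] by (simp add: add.assoc)

text \<open>On the rationals, translation by 1, doubling and \<open>v 1 = id\<close> satisfy the
  relations, but \<open>v 1\<close> has to move \<open>q = 1/2\<close>. An integer coordinate is
  therefore added. The increment of \<open>v 1\<close> is 1-periodic, so \<open>v 1\<close> commutes
  with \<open>t\<close>. The increment \<open>g\<close> of \<open>v 2\<close> must satisfy
  \<open>g (x + 1) = g x + half_ind (2 * x + 1)\<close>, and the factor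
  \<open>\<lfloor>x\<rfloor>\<close> solves this.\<close>

lemma hydra_action_2:
  "hydra_action 2 (\<lambda>(x, c). (x + 1, c))
     (\<lambda>i. if i = 1 then (\<lambda>(x, c). (x, c + half_ind x))
          else (\<lambda>(x, c). (2 * x, c + \<lfloor>x\<rfloor> * half_ind (2 * x)))) (0 :: rat, 0 :: int)"
proof -
  have t: "bij (\<lambda>(x, c). (x + 1, c) :: rat \<times> int)"
    by (rule o_bij[of "\<lambda>(x, c). (x - 1, c)"]) auto
  have v1: "bij (\<lambda>(x, c). (x, c + half_ind x))"
    by (rule o_bij[of "\<lambda>(x, c). (x, c - half_ind x)"]) auto
  have v2: "bij (\<lambda>(x, c). (2 * x, c + \<lfloor>x\<rfloor> * half_ind (2 * x)))"
    by (rule o_bij[of "\<lambda>(x, c). (x / 2, c - \<lfloor>x / 2\<rfloor> * half_ind x)"]) auto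
  have pow: "((\<lambda>(x, c). (x + 1, c)) ^^ n) (0 :: rat, 0 :: int) = (of_nat n, 0)" for n
    by (induction n) auto
  have floor_half: "\<lfloor>1 / 2 :: rat\<rfloor> = 0" by (rule floor_unique) simp_all
  have half_0: "half_ind 0 = 0" by (simp add: half_ind_def)
  have half: "half_ind (1 / 2) = 1" by (simp add: half_ind_def frac_def floor_half)
  show ?thesis
    unfolding hydra_action_def
  proof (intro conjI)
    show "\<exists>q. (if (2::nat) = 1 then \<lambda>(x, c). (x, c + half_ind x)
          else (\<lambda>(x, c). (2 * x, c + \<lfloor>x\<rfloor> * half_ind (2 * x)))) q = (\<lambda>(x, c). (x + 1, c)) (0, 0) \<and>
        (if (1::nat) = 1 then \<lambda>(x, c). (x, c + half_ind x)
          else (\<lambda>(x, c). (2 * x, c + \<lfloor>x\<rfloor> * half_ind (2 * x)))) q \<noteq> q"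
      by (intro exI[of _ "(1 / 2, 0)"]) (simp add: half floor_half)
  qed (auto simp: t v1 v2 pow half_0 half_ind_add_1 half_ind_add_2 distrib_right simp del: One_nat_def)
qed

lemma hydra_action_transport:
  fixes h :: "'x \<Rightarrow> 'y"
  assumes "hydra_action k t v p" and h: "bij h"
  shows "hydra_action k (h \<circ> t \<circ> fun_inv h) (\<lambda>i. h \<circ> v i \<circ> fun_inv h) (h p)"
proof -
  have [simp]: "fun_inv h (h x) = x" "h (fun_inv h y) = y" "h x = h x' \<longleftrightarrow> x = x'" for x y x'
    using h by (auto simp: bij_is_inj bij_is_surj surj_f_inv_f inj_eq)
  have pow: "((h \<circ> t \<circ> fun_inv h) ^^ n) (h p) = h ((t ^^ n) p)" for n
    by (induction n) auto
  have b: "bij f \<Longrightarrow> bij (h \<circ> f \<circ> fun_inv h)" for f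
    using h by (intro bij_comp bij_imp_bij_inv) auto
  from assms(1) obtain q where q: "v 2 q = t p" "v 1 q \<noteq> q"
    by (auto simp: hydra_action_def)
  then have "\<exists>q. h (v 2 (fun_inv h q)) = h (t p) \<and> h (v 1 (fun_inv h q)) \<noteq> q"
    by (intro exI[of _ "h q"]) auto
  then show ?thesis
    using assms(1) by (auto simp: hydra_action_def b pow)
qed

section \<open>Infinite orbits of the base point\<close>

lemma bij_infinite_orbit:
  assumes t: "bij t" and p: "\<And>n. n > 0 \<Longrightarrow> (t ^^ n) p \<noteq> p"
  shows "\<exists>\<phi> :: int \<Rightarrow> 'x. inj \<phi> \<and> \<phi> 0 = p \<and> (\<forall>n. t (\<phi> n) = \<phi> (n + 1))"
proof -
  \<comment> \<open>Since \<open>nat\<close> truncates at 0, at most one of the two iterates is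
    nontrivial.\<close>
  define \<phi> where "\<phi> n = (t ^^ nat n) ((fun_inv t ^^ nat (- n)) p)" for n :: int
  have step: "t (\<phi> n) = \<phi> (n + 1)" for n
  proof (cases "n \<ge> 0")
    case True
    then have "nat (n + 1) = Suc (nat n)" "nat (- n) = 0" "nat (- (n + 1)) = 0" by auto
    then show ?thesis by (simp add: \<phi>_def)
  next
    case False
    then have "nat (- n) = Suc (nat (- (n + 1)))" "nat n = 0" "nat (n + 1) = 0" by auto
    then show ?thesis using t by (simp add: \<phi>_def bij_is_surj surj_f_inv_f)
  qed
  have steps: "(t ^^ n) (\<phi> a) = \<phi> (a + int n)" for n a
    by (induction n) (simp_all add: step algebra_simps)
  \<comment> \<open>Injectivity of \<open>t\<close> lets a coincidence
    \<open>\<phi> a = \<phi> b\<close> be translated to one with \<open>\<phi> 0\<close>.\<close>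
  have shift: "\<phi> (a + d) = \<phi> a \<longleftrightarrow> \<phi> d = \<phi> 0" for a d
  proof (induction a rule: int_induct[of _ 0])
    case (step1 i)
    have "\<phi> (i + 1 + d) = \<phi> (i + 1) \<longleftrightarrow> t (\<phi> (i + d)) = t (\<phi> i)"
      by (simp add: step algebra_simps)
    then show ?case using step1 t by (simp add: bij_is_inj inj_eq)
  next
    case (step2 i)
    have "\<phi> (i + d) = \<phi> i \<longleftrightarrow> t (\<phi> (i - 1 + d)) = t (\<phi> (i - 1))"
      by (simp add: step algebra_simps)
    then show ?case using step2 t by (simp add: bij_is_inj inj_eq)
  qed simp
  have 0: "\<phi> 0 = p" by (simp add: \<phi>_def)
  have "\<phi> a \<noteq> \<phi> b" if "a < b" for a b
  proof
    assume "\<phi> a = \<phi> b"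
    then have "\<phi> (b - a) = \<phi> 0" using shift[of a "b - a"] by simp
    moreover have "\<phi> (b - a) = (t ^^ nat (b - a)) p"
      using steps[of "nat (b - a)" 0] that 0 by simp
    ultimately show False using p[of "nat (b - a)"] that 0 by simp
  qed
  then have "inj \<phi>" by (metis injI linorder_neqE)
  with 0 step show ?thesis by blast
qed

text \<open>
  On the forward \<open>t\<close>-orbit of \<open>p\<close> the \<open>v\<^sub>i\<close> act as the fast growing functions of the hydra game.
\<close>

lemma hydra_action_forward:
  assumes "hydra_action k t v p" "1 \<le> i" "i \<le> k"
  shows "\<exists>m\<ge>n. v i ((t ^^ n) p) = (t ^^ m) p"
  using assms(2,3)
proof (induction i arbitrary: n rule: nat_induct_at_least)
  case base
  have "v 1 ((t ^^ n) p) = (t ^^ n) p"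
    using assms by (induction n) (auto simp: hydra_action_def)
  then show ?case by auto
next
  case (Suc i)
  show ?case
  proof (induction n)
    case 0
    have "v (Suc i) p = p" using assms(1) Suc.prems by (auto simp: hydra_action_def)
    then show ?case by (intro exI[of _ 0]) auto
  next
    case (Suc n)
    then obtain m where m: "m \<ge> n" "v (Suc i) ((t ^^ n) p) = (t ^^ m) p" by auto
    obtain l where l: "l \<ge> Suc m" "v i ((t ^^ Suc m) p) = (t ^^ l) p"
      using Suc.prems \<open>Suc i \<le> k\<close> \<open>\<And>n. i \<le> k \<Longrightarrow> \<exists>m\<ge>n. v i ((t ^^ n) p) = (t ^^ m) p\<close>[of "Suc m"]
      by auto
    \<comment> \<open>This is the recursion of the hydra functions; \<open>v i\<close> does not
      lower the exponent and each \<open>t\<close> raises it by one.\<close>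
    have "v (Suc i) ((t ^^ Suc n) p) = t (v i (t (v (Suc i) ((t ^^ n) p))))"
      using assms(1) \<open>Suc i \<le> k\<close> \<open>1 \<le> i\<close> by (simp add: hydra_action_def)
    also have "\<dots> = (t ^^ Suc l) p" using m l by simp
    finally show ?case using m l by (intro exI[of _ "Suc l"]) auto
  qed
qed

text \<open>Each application of \<open>t v_k t\<close> strictly raises the exponent on the forward
  \<open>t\<close>-orbit of \<open>p\<close>. The new \<open>v (k + 1)\<close> has to conjugate
  \<open>t\<close> to this map while fixing \<open>p\<close>, so both orbits of \<open>p\<close>
  must be infinite.\<close>

lemma hydra_action_orbit_infinite:
  assumes H: "hydra_action k t v p" and k: "1 \<le> k" and n: "n > 0"
  shows "((\<lambda>x. t (v k (t x))) ^^ n) p \<noteq> p"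
proof -
  have "\<exists>m\<ge>n. ((\<lambda>x. t (v k (t x))) ^^ n) p = (t ^^ m) p" for n
  proof (induction n)
    case (Suc n)
    then obtain m where m: "m \<ge> n" "((\<lambda>x. t (v k (t x))) ^^ n) p = (t ^^ m) p" by auto
    obtain l where "l \<ge> Suc m" "v k ((t ^^ Suc m) p) = (t ^^ l) p"
      using hydra_action_forward[OF H k, of "Suc m"] by auto
    with m show ?case by (intro exI[of _ "Suc l"]) auto
  qed (auto intro: exI[of _ 0])
  with n H show ?thesis by (metis hydra_action_def less_le_trans)
qed

section \<open>The conjugating swindle\<close>

text \<open>
  An Eilenberg swindle: a conjugacy from \<open>X + \<nat> \<times> (X + X')\<close> to \<open>X' + \<nat> \<times> (X + X')\<close>, where \<open>X\<close> and
  \<open>X'\<close> are the same set with the permutations \<open>t\<close> and \<open>u\<close>. On the free orbits parametrised by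
  \<open>\<phi>\<close> and \<open>\<psi>\<close> it is corrected so as to fix the common base point \<open>\<phi> 0 = \<psi> 0\<close>.
\<close>

fun swindle :: "(int \<Rightarrow> 'x) \<Rightarrow> (int \<Rightarrow> 'x) \<Rightarrow> 'x + nat \<times> ('x + 'x) \<Rightarrow> 'x + nat \<times> ('x + 'x)" where
  "swindle \<phi> \<psi> (Inl x) = (if x \<in> range \<phi> then Inl (\<psi> (fun_inv \<phi> x)) else Inr (0, Inl x))"
| "swindle \<phi> \<psi> (Inr (m, Inl x)) = Inr (Suc m, Inl x)"
| "swindle \<phi> \<psi> (Inr (Suc m, Inr x)) = Inr (m, Inr x)"
| "swindle \<phi> \<psi> (Inr (0, Inr x)) = (if x \<in> range \<psi> then Inr (0, Inl (\<phi> (fun_inv \<psi> x))) else Inl x)"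

fun swap_sides :: "'x + nat \<times> ('x + 'x) \<Rightarrow> 'x + nat \<times> ('x + 'x)" where
  "swap_sides (Inl x) = Inl x"
| "swap_sides (Inr (m, Inl x)) = Inr (m, Inr x)"
| "swap_sides (Inr (m, Inr x)) = Inr (m, Inl x)"

lemma swap_sides_swap_sides [simp]: "swap_sides (swap_sides z) = z"
  by (cases z rule: swap_sides.cases) auto

text \<open>The swindle moves copies of one kind up a level and copies of the other kind down.
  Exchanging the kinds, together with \<open>\<phi>\<close> and \<open>\<psi>\<close>, reverses the
  motion.\<close>

lemma swindle_inverse:
  assumes "inj \<phi>" "inj \<psi>"
  shows "swap_sides (swindle \<psi> \<phi> (swap_sides (swindle \<phi> \<psi> z))) = z"
  using assms by (cases "(\<phi>, \<psi>, z)" rule: swindle.cases) auto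

lemma bij_swindle:
  assumes "inj \<phi>" "inj \<psi>"
  shows "bij (swindle \<phi> \<psi>)"
proof (rule o_bij)
  show "(swap_sides \<circ> swindle \<psi> \<phi> \<circ> swap_sides) \<circ> swindle \<phi> \<psi> = id"
    using assms by (auto simp: swindle_inverse)
  show "swindle \<phi> \<psi> \<circ> (swap_sides \<circ> swindle \<psi> \<phi> \<circ> swap_sides) = id"
  proof
    fix z
    have "swap_sides (swindle \<phi> \<psi> (swap_sides (swindle \<psi> \<phi> (swap_sides z)))) = swap_sides z"
      using assms by (simp add: swindle_inverse)
    then show "(swindle \<phi> \<psi> \<circ> (swap_sides \<circ> swindle \<psi> \<phi> \<circ> swap_sides)) z = id z"
      by (metis comp_apply id_apply swap_sides_swap_sides)
  qed
qed

text \<open>Off the chosen orbits, points pass between copies carrying the same permutation; on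
  them, \<open>\<phi> n\<close> and \<open>\<psi> n\<close> are exchanged for one another. Both
  ranges are invariant, so the case distinctions are preserved.\<close>

lemma swindle_conj:
  assumes "inj t" "inj u" "inj \<phi>" "inj \<psi>"
    and "\<And>n. t (\<phi> n) = \<phi> (n + 1)" "\<And>n. u (\<psi> n) = \<psi> (n + 1)"
  shows "swindle \<phi> \<psi> (map_sum t (map_prod id (map_sum t u)) z) =
    map_sum u (map_prod id (map_sum t u)) (swindle \<phi> \<psi> z)"
proof -
  have range_iff: "f x \<in> range \<chi> \<longleftrightarrow> x \<in> range \<chi>"
    if "inj f" "\<And>n. f (\<chi> n) = \<chi> (n + 1)" for f :: "'a \<Rightarrow> 'a" and \<chi> :: "int \<Rightarrow> 'a" and x
  proof
    assume "f x \<in> range \<chi>"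
    then obtain n where "f x = \<chi> (n - 1 + 1)" by auto
    then have "f x = f (\<chi> (n - 1))" by (simp only: that(2))
    with that(1) show "x \<in> range \<chi>" by (auto simp: inj_eq)
  qed (use that in auto)
  show ?thesis
    using assms range_iff[of t \<phi>] range_iff[of u \<psi>]
    by (cases "(\<phi>, \<psi>, z)" rule: swindle.cases) auto
qed

lemma bij_map_sum_prod:
  assumes "bij f" "bij g" "bij h"
  shows "bij (map_sum f (map_prod (id :: nat \<Rightarrow> nat) (map_sum g h)))"
proof (rule o_bij)
  show "map_sum (fun_inv f) (map_prod id (map_sum (fun_inv g) (fun_inv h))) \<circ> map_sum f (map_prod id (map_sum g h)) = id"
    using assms by (simp add: map_sum.comp map_prod.comp map_sum.id map_prod.id bij_is_inj)
  show "map_sum f (map_prod id (map_sum g h)) \<circ> map_sum (fun_inv f) (map_prod id (map_sum (fun_inv g) (fun_inv h))) = id"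
    using assms by (simp add: map_sum.comp map_prod.comp map_sum.id map_prod.id bij_is_surj surj_iff[THEN iffD1])
qed

section \<open>Extending an action from \<open>k\<close> to \<open>k + 1\<close>\<close>

text \<open>
  The elements \<open>t\<close> and \<open>u = t v\<^sub>k t\<close> need not be conjugate permutations: for \<open>k = 2\<close>, for instance,
  \<open>u\<close> fixes \<open>t\<^sup>-\<^sup>3 p\<close>. They become conjugate after adding infinitely many copies of
  the sets \<open>(X, t)\<close> and \<open>(X, u)\<close>, on which every \<open>v\<^sub>i\<close> acts as \<open>t\<^sup>-\<^sup>1\<close>, so that \<open>t v\<^sub>i t = t\<close> there.
\<close>

lemma hydra_action_Suc:
  fixes t :: "'x \<Rightarrow> 'x"
  assumes H: "hydra_action k t v p" and k: "2 \<le> k"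
  shows "\<exists>t' v' p'. hydra_action (Suc k) t' v' (p' :: 'x + nat \<times> ('x + 'x))"
proof -
  define u where "u x = t (v k (t x))" for x
  have t: "bij t" using H by (simp add: hydra_action_def)
  have vk: "bij (v k)" using H k by (simp add: hydra_action_def)
  have u: "bij u"
    using bij_comp[OF t bij_comp[OF vk t]] by (simp add: u_def[abs_def] comp_def)
  obtain \<phi> where \<phi>: "inj \<phi>" "\<phi> (0::int) = p" "\<And>n. t (\<phi> n) = \<phi> (n + 1)"
    using bij_infinite_orbit[OF t, of p] H by (auto simp: hydra_action_def)
  obtain \<psi> where \<psi>: "inj \<psi>" "\<psi> (0::int) = p" "\<And>n. u (\<psi> n) = \<psi> (n + 1)"
    using bij_infinite_orbit[OF u, of p] hydra_action_orbit_infinite[OF H] k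
    unfolding u_def[abs_def] by auto
  define t' where "t' = map_sum t (map_prod (id :: nat \<Rightarrow> nat) (map_sum t u))"
  define w where "w i = map_sum (v i) (map_prod (id :: nat \<Rightarrow> nat) (map_sum (fun_inv t) (fun_inv u)))" for i
  define v' where "v' i = (if i = Suc k then swindle \<phi> \<psi> else w i)" for i
  have inv_simps [simp]: "fun_inv t (t x) = x" "t (fun_inv t x) = x" "fun_inv u (u x) = x" "u (fun_inv u x) = x" for x
    using t u by (auto simp: bij_is_inj bij_is_surj surj_f_inv_f)
  have p: "fun_inv \<phi> p = 0" "fun_inv \<psi> p = 0" "p \<in> range \<phi>"
    using \<phi> \<psi> by (metis inv_f_f rangeI)+
  \<comment> \<open>On the old points this is \<open>u\<close>; on the added copies
    \<open>t t^-1 t = t\<close>, and likewise for \<open>u\<close>. It is thus exactly the map to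
    which the swindle conjugates \<open>t'\<close>.\<close>
  have "t' (w k (t' z)) = map_sum u (map_prod id (map_sum t u)) z" for z
    by (cases z rule: swap_sides.cases) (simp_all add: t'_def w_def flip: u_def)
  then have conj: "swindle \<phi> \<psi> (t' z) = t' (w k (t' (swindle \<phi> \<psi> z)))" for z
    using swindle_conj[OF bij_is_inj[OF t] bij_is_inj[OF u] \<phi>(1) \<psi>(1) \<phi>(3) \<psi>(3), of z]
    by (simp add: t'_def)
  have w_conj: "w (Suc i) (t' z) = t' (w i (t' (w (Suc i) z)))" if "1 \<le> i" "i < k" for i z
    using H that by (cases z rule: swap_sides.cases) (auto simp: t'_def w_def hydra_action_def)
  have w_comm: "w 1 (t' z) = t' (w 1 z)" for z
    using H by (cases z rule: swap_sides.cases) (auto simp: t'_def w_def hydra_action_def)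
  have bij_t': "bij t'" unfolding t'_def by (intro bij_map_sum_prod t u)
  have v'_p: "bij (v' i) \<and> v' i (Inl p) = Inl p" if "i \<in> {1..Suc k}" for i
  proof (cases "i = Suc k")
    case True
    then show ?thesis using p \<psi>(2) by (simp add: v'_def bij_swindle \<phi> \<psi>(1))
  next
    case False
    then have "bij (v i)" "v i p = p" using H that by (auto simp: hydra_action_def)
    then show ?thesis
      using False by (simp add: v'_def w_def bij_map_sum_prod bij_imp_bij_inv t u)
  qed
  have "(t' ^^ n) (Inl p) = Inl ((t ^^ n) p)" for n
    by (induction n) (auto simp: t'_def)
  then have t'_pow: "(t' ^^ n) (Inl p) \<noteq> Inl p" if "n > 0" for n
    using H that by (simp add: hydra_action_def)
  \<comment> \<open>The old witness survives: as \<open>2 \<le> k\<close>, the indices 1 and 2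
    differ from \<open>Suc k\<close>, where the swindle is placed.\<close>
  obtain q where "v 2 q = t p" "v 1 q \<noteq> q" using H by (auto simp: hydra_action_def)
  then have "v' 2 (Inl q) = t' (Inl p)" "v' 1 (Inl q) \<noteq> Inl q"
    using k by (auto simp: v'_def w_def t'_def)
  then have "hydra_action (Suc k) t' v' (Inl p)"
    unfolding hydra_action_def
    using bij_t' v'_p t'_pow w_comm w_conj conj k by (auto simp: v'_def less_Suc_eq)
  then show ?thesis by blast
qed

text \<open>Extending an action changes the type of points; returning to \<open>nat\<close> each
  time makes induction on \<open>k\<close> possible.\<close>

lemma hydra_action_to_nat:
  fixes p :: "'x :: countable"
  assumes "hydra_action k t v p" and "infinite (UNIV :: 'x set)"
  shows "\<exists>t' v' p'. hydra_action k t' v' (p' :: nat)"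
  using hydra_action_transport[OF assms(1) to_nat_on_infinite[OF countableI_type assms(2)]] by blast

lemma hydra_action_exists:
  assumes "k \<ge> 2"
  shows "\<exists>t v p. hydra_action k t v (p :: nat)"
  using assms
proof (induction k rule: nat_induct_at_least)
  case base
  have "infinite (UNIV :: (rat \<times> int) set)" by (simp add: finite_prod)
  with hydra_action_2 show ?case by (rule hydra_action_to_nat)
next
  case (Suc k)
  then obtain t v and p :: nat where "hydra_action k t v p" by blast
  from hydra_action_Suc[OF this Suc(1)]
  show ?case by (elim exE, intro hydra_action_to_nat) (auto simp: finite_Plus_UNIV_iff)
qed

section \<open>The groups \<open>G\<^sub>k\<close>\<close>

lemma BijGroup_UNIV:
  "carrier (BijGroup UNIV) = {f. bij f}"
  "bij f \<Longrightarrow> bij g \<Longrightarrow> f \<otimes>\<^bsub>BijGroup UNIV\<^esub> g = f \<circ> g"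
  "\<one>\<^bsub>BijGroup UNIV\<^esub> = id"
  by (auto simp: BijGroup_def Bij_def compose_def fun_eq_iff)

lemma inv_BijGroup_UNIV: "bij f \<Longrightarrow> inv\<^bsub>BijGroup UNIV\<^esub> f = fun_inv f"
  by (subst inv_BijGroup) (auto simp: Bij_def)

lemma t_a_relations:
  assumes "1 \<le> i" "i \<le> k"
  shows "a_elt k i \<otimes>\<^bsub>G_grp k\<^esub> t_elt k =
    t_elt k \<otimes>\<^bsub>G_grp k\<^esub> (if i = 1 then a_elt k 1 else a_elt k i \<otimes>\<^bsub>G_grp k\<^esub> a_elt k (i - 1))"
proof -
  let ?R = "pres_rel (gens_G k) (rels_G k)"
  let ?r = "if i = 1 then aw 1 else aw i @ aw (i - 1)"
  have w: "aw i \<in> words (gens_G k)" "tw \<in> words (gens_G k)" "?r \<in> words (gens_G k)"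
    using assms by (auto simp: aw_def tw_def gens_G_def image_iff)
  have "(word_conj (aw i) tw, ?r) \<in> rels_G k" using assms by (auto simp: rels_G_def)
  then have "(word_conj (aw i) tw, ?r) \<in> ?R"
    using w by (intro pres_relation) (auto simp: word_conj_def)
  then have 1: "(tw @ word_conj (aw i) tw, tw @ ?r) \<in> ?R"
    using w by (intro pres_append pres_refl)
  have "(tw @ word_inv tw, []) \<in> ?R"
    using pres_cancel[of T "gens_G k" True] by (simp add: tw_def gens_G_def)
  then have "((tw @ word_inv tw) @ aw i @ tw, [] @ aw i @ tw) \<in> ?R"
    using w by (intro pres_append pres_refl) auto
  with 1 have "(aw i @ tw, tw @ ?r) \<in> ?R"
    by (metis append.assoc append_Nil pres_sym pres_trans word_conj_def)
  then have "word_class (gens_G k) (rels_G k) (aw i @ tw) =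
      word_class (gens_G k) (rels_G k) (tw @ ?r)"
    using w by (subst word_class_eq_iff) auto
  then show ?thesis
    using w by (auto simp: a_elt_def t_elt_def G_grp_def split: if_splits)
qed

section \<open>The element that finite quotients cannot separate\<close>

definition inseparable_elt :: "nat \<Rightarrow> gen word set" where
  "inseparable_elt k =
    (let s = a_elt k 1 \<otimes>\<^bsub>G_grp k\<^esub> t_elt k; y = a_elt k 2 \<otimes>\<^bsub>G_grp k\<^esub> t_elt k;
         z = y \<otimes>\<^bsub>G_grp k\<^esub> t_elt k \<otimes>\<^bsub>G_grp k\<^esub> inv\<^bsub>G_grp k\<^esub> y
     in inv\<^bsub>G_grp k\<^esub> z \<otimes>\<^bsub>G_grp k\<^esub> s \<otimes>\<^bsub>G_grp k\<^esub> z)"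

lemma inseparable_elt_in_finite_quotient:
  assumes k: "k \<ge> 2" and Q: "group Q" "finite (carrier Q)" and \<phi>: "\<phi> \<in> hom (G_grp k) Q"
  shows "\<phi> (inseparable_elt k) \<in> \<phi> ` H_sub k"
proof -
  interpret G: group "G_grp k" by (rule group_G_grp)
  interpret Q: group Q by (rule Q)
  interpret \<phi>: group_hom "G_grp k" Q \<phi> by unfold_locales (rule \<phi>)
  define a b t where "a = a_elt k 1" and "b = a_elt k 2" and "t = t_elt k"
  have c [simp]: "a \<in> carrier (G_grp k)" "b \<in> carrier (G_grp k)" "t \<in> carrier (G_grp k)"
    using k by (auto simp: a_def b_def t_def a_elt_carrier t_elt_carrier)
  define s y where "s = a \<otimes>\<^bsub>G_grp k\<^esub> t" and "y = b \<otimes>\<^bsub>G_grp k\<^esub> t"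
  have c' [simp]: "s \<in> carrier (G_grp k)" "y \<in> carrier (G_grp k)" by (auto simp: s_def y_def)
  have H: "s \<in> H_sub k" "y \<in> H_sub k"
    using k by (auto simp: s_def y_def a_def b_def t_def H_sub_def intro!: generate.incl)
  have at: "a \<otimes>\<^bsub>G_grp k\<^esub> t = t \<otimes>\<^bsub>G_grp k\<^esub> a"
    using t_a_relations[of 1 k] k by (simp add: a_def t_def)
  have bt: "b \<otimes>\<^bsub>G_grp k\<^esub> t = t \<otimes>\<^bsub>G_grp k\<^esub> (b \<otimes>\<^bsub>G_grp k\<^esub> a)"
    using t_a_relations[of 2 k] k by (simp add: a_def b_def t_def)
  have st: "s \<otimes>\<^bsub>G_grp k\<^esub> t = t \<otimes>\<^bsub>G_grp k\<^esub> s"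
    by (simp add: s_def at G.m_assoc flip: G.m_assoc[of t a t])
  \<comment> \<open>With \<open>b t = t b a\<close>:
    \<open>y t t = t b a t t = t b s t = t b t s = t y s\<close>.\<close>
  have "y \<otimes>\<^bsub>G_grp k\<^esub> (t \<otimes>\<^bsub>G_grp k\<^esub> t) = t \<otimes>\<^bsub>G_grp k\<^esub> (b \<otimes>\<^bsub>G_grp k\<^esub> (s \<otimes>\<^bsub>G_grp k\<^esub> t))"
    by (simp add: y_def bt s_def G.m_assoc)
  also have "\<dots> = t \<otimes>\<^bsub>G_grp k\<^esub> y \<otimes>\<^bsub>G_grp k\<^esub> s"
    by (simp add: st y_def G.m_assoc)
  finally have "t \<otimes>\<^bsub>G_grp k\<^esub> y = y \<otimes>\<^bsub>G_grp k\<^esub> (t \<otimes>\<^bsub>G_grp k\<^esub> t) \<otimes>\<^bsub>G_grp k\<^esub> inv\<^bsub>G_grp k\<^esub> s"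
    by (simp add: G.inv_solve_right)
  then have ty: "t \<otimes>\<^bsub>G_grp k\<^esub> y = y \<otimes>\<^bsub>G_grp k\<^esub> (t \<otimes>\<^bsub>G_grp k\<^esub> t \<otimes>\<^bsub>G_grp k\<^esub> inv\<^bsub>G_grp k\<^esub> s)"
    by (simp add: G.m_assoc)
  have "subgroup (\<phi> ` H_sub k) Q"
    by (rule \<phi>.subgroup_img_is_subgroup[OF subgroup_H_sub])
  moreover have "\<phi> s \<otimes>\<^bsub>Q\<^esub> \<phi> t = \<phi> t \<otimes>\<^bsub>Q\<^esub> \<phi> s"
    using arg_cong[OF st, of \<phi>] by simp
  moreover have "\<phi> t \<otimes>\<^bsub>Q\<^esub> \<phi> y = \<phi> y \<otimes>\<^bsub>Q\<^esub> (\<phi> t \<otimes>\<^bsub>Q\<^esub> \<phi> t \<otimes>\<^bsub>Q\<^esub> inv\<^bsub>Q\<^esub> \<phi> s)"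
    using arg_cong[OF ty, of \<phi>] by simp
  ultimately have "inv\<^bsub>Q\<^esub> (\<phi> y \<otimes>\<^bsub>Q\<^esub> \<phi> t \<otimes>\<^bsub>Q\<^esub> inv\<^bsub>Q\<^esub> \<phi> y) \<otimes>\<^bsub>Q\<^esub> \<phi> s
      \<otimes>\<^bsub>Q\<^esub> (\<phi> y \<otimes>\<^bsub>Q\<^esub> \<phi> t \<otimes>\<^bsub>Q\<^esub> inv\<^bsub>Q\<^esub> \<phi> y) \<in> \<phi> ` H_sub k"
    using H by (intro Q.twisted_conjugate_in_subgroup Q(2)) auto
  then show ?thesis
    by (simp add: inseparable_elt_def Let_def del: One_nat_def flip: a_def b_def t_def s_def y_def)
qed

lemma inseparable_elt_carrier:
  assumes "k \<ge> 2"
  shows "inseparable_elt k \<in> carrier (G_grp k)"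
proof -
  interpret G: group "G_grp k" by (rule group_G_grp)
  show ?thesis
    using assms by (simp add: inseparable_elt_def Let_def a_elt_carrier t_elt_carrier)
qed

lemma inseparable_elt_notin_H_sub:
  assumes k: "k \<ge> 2"
  shows "inseparable_elt k \<notin> H_sub k"
proof -
  obtain \<tau> v and p :: nat where act: "hydra_action k \<tau> v p"
    using hydra_action_exists[OF k] by blast
  have \<tau>: "bij \<tau>" and v: "\<And>i. 1 \<le> i \<Longrightarrow> i \<le> k \<Longrightarrow> bij (v i)" "\<And>i. 1 \<le> i \<Longrightarrow> i \<le> k \<Longrightarrow> v i p = p"
    using act by (auto simp: hydra_action_def)
  let ?B = "BijGroup (UNIV :: nat set)"
  interpret G: group "G_grp k" by (rule group_G_grp)
  interpret B: group ?B by (rule group_BijGroup)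
  \<comment> \<open>As \<open>v i\<close> is the action of the inverse of \<open>a_i t\<close>, the
    generator \<open>a_i\<close> acts as \<open>(v i)^-1 \<tau>^-1\<close>.\<close>
  define f where "f x = (case x of T \<Rightarrow> \<tau> | A i \<Rightarrow> fun_inv (v i) \<circ> fun_inv \<tau>)" for x
  have fb: "bij (f x)" if "x \<in> gens_G k" for x
    using that \<tau> v(1) by (auto simp: f_def gens_G_def intro!: bij_comp bij_imp_bij_inv)
  then have f: "f \<in> gens_G k \<rightarrow> carrier ?B" by (auto simp: BijGroup_UNIV)
  have rel: "fun_inv \<tau> \<circ> (f (A i) \<circ> \<tau>) = (if i = 1 then f (A 1) else f (A i) \<circ> f (A (i - 1)))"
    if i: "1 \<le> i" "i \<le> k" for i
  proof -
    \<comment> \<open>Inverting both sides of the inverse-free relation between the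
      \<open>v i\<close> gives the defining relation of the group.\<close>
    have "v i \<circ> \<tau> = (if i = 1 then \<tau> \<circ> v 1 else \<tau> \<circ> (v (i - 1) \<circ> (\<tau> \<circ> v i)))"
      using act i unfolding hydra_action_def
      by (cases i) (auto simp: fun_eq_iff dest: spec[of _ "i - 1"])
    from arg_cong[OF this, of fun_inv]
    have "fun_inv \<tau> \<circ> fun_inv (v i) = (if i = 1 then fun_inv (v i) \<circ> fun_inv \<tau>
        else fun_inv (v i) \<circ> fun_inv \<tau> \<circ> fun_inv (v (i - 1)) \<circ> fun_inv \<tau>)"
      using \<tau> v(1)[of i] v(1)[of "i - 1"] i
      by (auto simp: o_inv_distrib bij_comp comp_assoc split: if_splits)
    then show ?thesis
      using \<tau> by (auto simp: f_def fun_eq_iff bij_is_inj)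
  qed
  have f_T: "f T = \<tau>" by (simp add: f_def)
  have eval_aw: "eval_word ?B f (aw i) = f (A i)" if "1 \<le> i" "i \<le> k" for i
    using fb[of "A i"] that by (simp add: eval_word_def aw_def gens_G_def BijGroup_UNIV)
  have eval_tw: "eval_word ?B f tw = \<tau>"
    using \<tau> by (simp add: eval_word_def tw_def BijGroup_UNIV f_T)
  have "eval_word ?B f x = eval_word ?B f x'" if R: "(x, x') \<in> rels_G k" for x x'
  proof -
    from R consider "x = word_conj (aw 1) tw" "x' = aw 1"
      | i where "1 < i" "i \<le> k" "x = word_conj (aw i) tw" "x' = aw i @ aw (i - 1)"
      unfolding rels_G_def by blast
    then obtain i where i: "1 \<le> i" "i \<le> k" "x = word_conj (aw i) tw"
        "x' = (if i = 1 then aw 1 else aw i @ aw (i - 1))"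
      using k by cases (metis order_refl one_le_numeral order_trans, metis less_imp_le nat_neq_iff)
    have fi: "bij (f (A i))" "i > 1 \<Longrightarrow> bij (f (A (i - 1)))"
      using i by (auto intro!: fb simp: gens_G_def image_iff)
    have "eval_word ?B f x = fun_inv \<tau> \<circ> (f (A i) \<circ> \<tau>)"
      using \<tau> fi i(3)
      by (simp add: eval_word_def word_conj_def aw_def tw_def f_T BijGroup_UNIV inv_BijGroup_UNIV
          bij_comp bij_imp_bij_inv)
    also have "\<dots> = eval_word ?B f x'"
      using fi i by (auto simp: rel eval_word_def aw_def BijGroup_UNIV)
    finally show ?thesis .
  qed
  then obtain \<phi> where \<phi>: "\<phi> \<in> hom (G_grp k) ?B"
    "\<And>w. w \<in> words (gens_G k) \<Longrightarrow> \<phi> (word_class (gens_G k) (rels_G k) w) = eval_word ?B f w"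
    using B.presented_group_universal[OF f, of "rels_G k"] unfolding G_grp_def by blast
  interpret \<phi>: group_hom "G_grp k" ?B \<phi> by unfold_locales (rule \<phi>)
  have \<phi>_t: "\<phi> (t_elt k) = \<tau>"
    unfolding t_elt_def by (subst \<phi>(2)) (simp_all add: eval_tw, simp add: tw_def gens_G_def)
  have \<phi>_a: "\<phi> (a_elt k i) = f (A i)" if "1 \<le> i" "i \<le> k" for i
    unfolding a_elt_def
    using that by (subst \<phi>(2)) (simp_all add: eval_aw, simp add: aw_def gens_G_def)
  have \<phi>_at: "\<phi> (a_elt k i \<otimes>\<^bsub>G_grp k\<^esub> t_elt k) = fun_inv (v i)" if "1 \<le> i" "i \<le> k" for i
    using that \<tau> fb[of "A i"]
    by (simp add: \<phi>_a \<phi>_t a_elt_carrier t_elt_carrier BijGroup_UNIV gens_G_def)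
      (auto simp: f_def fun_eq_iff bij_is_inj)
  have \<phi>_bij: "bij (\<phi> x)" if "x \<in> carrier (G_grp k)" for x
    using \<phi>.hom_closed[OF that] by (simp add: BijGroup_UNIV)
  have v_inv: "fun_inv (v i) p = p" if "1 \<le> i" "i \<le> k" for i
    using v[OF that] by (metis bij_is_inj inv_f_f)
  \<comment> \<open>\<open>H_sub k\<close> lies in the stabiliser of \<open>p\<close>, since its
    generators act as inverses of the \<open>v i\<close>.\<close>
  have fixes_p: "\<phi> h p = p" if "h \<in> H_sub k" for h
    using that unfolding H_sub_def
  proof (induction rule: generate.induct)
    case one
    show ?case by (simp add: BijGroup_UNIV)
  next
    case (incl h)
    then show ?case by (auto simp: \<phi>_at v_inv)
  next
    case (inv h)
    then obtain i where i: "1 \<le> i" "i \<le> k" "h = a_elt k i \<otimes>\<^bsub>G_grp k\<^esub> t_elt k" by auto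
    then have "h \<in> carrier (G_grp k)" by (simp add: a_elt_carrier t_elt_carrier)
    then have "\<phi> (inv\<^bsub>G_grp k\<^esub> h) = fun_inv (fun_inv (v i))"
      using \<phi>_bij[of h] \<phi>_at[OF i(1,2)] i(3) by (simp add: inv_BijGroup_UNIV)
    then show ?case using v i by (simp add: inv_inv_eq)
  next
    case (eng h h')
    then have "h \<in> carrier (G_grp k)" "h' \<in> carrier (G_grp k)"
      using subgroup.subset[OF subgroup_H_sub] unfolding H_sub_def by auto
    then show ?case using eng \<phi>_bij by (simp add: BijGroup_UNIV)
  qed
  define s y where "s = a_elt k 1 \<otimes>\<^bsub>G_grp k\<^esub> t_elt k" and "y = a_elt k 2 \<otimes>\<^bsub>G_grp k\<^esub> t_elt k"
  define z where "z = y \<otimes>\<^bsub>G_grp k\<^esub> t_elt k \<otimes>\<^bsub>G_grp k\<^esub> inv\<^bsub>G_grp k\<^esub> y"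
  have c [simp]: "s \<in> carrier (G_grp k)" "y \<in> carrier (G_grp k)" "t_elt k \<in> carrier (G_grp k)"
      "z \<in> carrier (G_grp k)"
    using k by (auto simp: s_def y_def z_def a_elt_carrier t_elt_carrier)
  obtain q where q: "v 2 q = \<tau> p" "v 1 q \<noteq> q" using act by (auto simp: hydra_action_def)
  have \<phi>_s: "\<phi> s = fun_inv (v 1)" and \<phi>_y: "\<phi> y = fun_inv (v 2)"
    using k \<phi>_at by (auto simp: s_def y_def)
  have "\<phi> z = fun_inv (v 2) \<circ> \<tau> \<circ> v 2"
    using k v(1)[of 2] \<tau>
    by (simp add: z_def \<phi>_y \<phi>_t BijGroup_UNIV inv_BijGroup_UNIV inv_inv_eq bij_comp bij_imp_bij_inv)
  \<comment> \<open>\<open>v 2\<close> fixes \<open>p\<close>, then \<open>\<tau> p = v 2 q\<close>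
    is pulled back to \<open>q\<close>.\<close>
  then have z: "\<phi> z p = q"
    using k v[of 2] by (simp add: bij_is_inj flip: q(1))
  show ?thesis
  proof
    assume "inseparable_elt k \<in> H_sub k"
    then have "\<phi> (inv\<^bsub>G_grp k\<^esub> z \<otimes>\<^bsub>G_grp k\<^esub> s \<otimes>\<^bsub>G_grp k\<^esub> z) p = p"
      by (intro fixes_p) (simp add: inseparable_elt_def Let_def z_def s_def y_def)
    then have "fun_inv (\<phi> z) (\<phi> s (\<phi> z p)) = p"
      using \<phi>_bij[of z] \<phi>_bij[of s]
      by (simp add: BijGroup_UNIV inv_BijGroup_UNIV bij_comp bij_imp_bij_inv)
    \<comment> \<open>Fixing \<open>p\<close> under the conjugate by \<open>z\<close> means that
      \<open>s\<close>, hence \<open>v 1\<close>, fixes \<open>q\<close>.\<close>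
    then have "\<phi> s q = q"
      using \<phi>_bij[of z] z by (metis bij_inv_eq_iff c(4))
    then show False
      using q(2) v(1)[of 1] k by (metis \<phi>_s bij_inv_eq_iff le_trans one_le_numeral order_refl)
  qed
qed

theorem lemma1p3:
  fixes k :: nat
  assumes "k > 1"
  shows "\<not> separable (G_grp k) (H_sub k)"
proof
  assume "separable (G_grp k) (H_sub k)"
  moreover have "inseparable_elt k \<in> carrier (G_grp k) - H_sub k"
    using assms inseparable_elt_carrier inseparable_elt_notin_H_sub by simp
  ultimately obtain Q :: "nat monoid" and \<phi> where "group Q" "finite (carrier Q)"
    "\<phi> \<in> epi (G_grp k) Q" "\<phi> (inseparable_elt k) \<notin> \<phi> ` H_sub k"
    unfolding separable_def by blast
  with inseparable_elt_in_finite_quotient[of k Q \<phi>] assms show False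
    by (simp add: epi_def)
qed

end
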